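(* Let $T\in\mathbb{N}$, let $\mathcal{X}$ and $\mathcal{U}$ be nonempty compact Polish spaces, let $f:\mathcal{X}\times\mathcal{U}\to\mathcal{X}$, $\ell:\mathcal{X}\times\mathcal{U}\to\mathbb{R}$ and $\phi:\mathcal{X}\to\mathbb{R}$ be continuous, and let $\rho_0\in\mathcal{P}(\mathcal{X})$. Let $p^\star(\rho_0)$ be the optimal value of the occupation-measure primal problem. Then the dual of the primal problem is the maximization over value functions $V_t\in C(\mathcal{X})$ $$d^\star(\rho_0):=\sup_{\{V_t\}_{t=0}^T\subset C(\mathcal{X})}\int_{\mathcal{X}}V_0\,d\rho_0$$ subject to $$V_T(x)\le\phi(x)\ \ (x\in\mathcal{X}),\qquad V_t(x)\le\ell(x,u)+V_{t+1}(f(x,u))\ \ ((x,u)\in\mathcal{X}\times\mathcal{U},\ t=0,\dots,T-1).$$ Strong duality holds, i.e. $p^\star(\rho_0)=d^\star(\rho_0)$. Moreover, the dual optimum is attained by the Bellman recursion: setting $V_T^\star:=\phi$ and $$V_t^\star(x)=\min_{u\in\mathcal{U}}\{\ell(x,u)+V_{t+1}^\star(f(x,u))\},\qquad t=T-1,\dots,0,$$ yields a dual optimal family $\{V_t^\star\}_{t=0}^T$, and there exists a primal optimal family $\{(\rho_t^\star,\lambda_t^\star)\}$ attaining the infimum in the primal problem.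
   Context: $\mathcal{P}(S)$ denotes the Borel probability measures on a Polish space $S$; $C(\mathcal{X})$ the continuous real-valued functions on $\mathcal{X}$; $\varphi_{\#}\mu$ the pushforward of $\mu$ under $\varphi$; $\pi_X:\mathcal{X}\times\mathcal{U}\to\mathcal{X}$, $\pi_X(x,u)=x$. Occupation-measure primal problem: with $\rho_0$ prescribed, $$p^\star(\rho_0):=\inf_{\{\rho_t,\lambda_t\}}\ \sum_{t=0}^{T-1}\int_{\mathcal{X}\times\mathcal{U}}\ell\,d\lambda_t+\int_{\mathcal{X}}\phi\,d\rho_T,$$ over $\rho_t\in\mathcal{P}(\mathcal{X})$ ($t=1,\dots,T$) and $\lambda_t\in\mathcal{P}(\mathcal{X}\times\mathcal{U})$ ($t=0,\dots,T-1$) subject to $(\pi_X)_{\#}\lambda_t=\rho_t$ and $\rho_{t+1}=f_{\#}\lambda_t$ for $t=0,\dots,T-1$. "Dual" means the Lagrangian dual of the primal regarded as a conic linear program over nonnegative finite measures (the fixed $\rho_0$ and the flow equations force unit masses), with continuous multipliers $V_t\in C(\mathcal{X})$ for the marginal and dynamics constraints and Lagrangian $$\mathcal{L}=\sum_{t=0}^{T-1}\int_{\mathcal{X}\times\mathcal{U}}[\ell(x,u)+V_{t+1}(f(x,u))-V_t(x)]\,d\lambda_t+\int_{\mathcal{X}}[\phi-V_T]\,d\rho_T+\int_{\mathcal{X}}V_0\,d\rho_0;$$ the dual is the supremum over $\{V_t\}$ of the infimum of $\mathcal{L}$ over nonnegative finite Borel measures $\lambda_0,\dots,\lambda_{T-1}$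 on $\mathcal{X}\times\mathcal{U}$ and $\rho_T$ on $\mathcal{X}$. *)

theory Defs
  imports "HOL-Probability.Probability"
begin

text \<open>
  A compact Polish space is a type of class \<open>polish_space\<close> whose universe is compact;
  nonemptiness is automatic. Families indexed by time are functions on \<open>nat\<close>, and only the
  entries in the stated index range are constrained or used. Optimal values live in \<open>ereal\<close>, so
  that infima and suprema are genuine for arbitrary (possibly empty or unbounded) sets.
\<close>

definition borel_prob_measures :: "'a::topological_space measure set" where
  "borel_prob_measures = {M. prob_space M \<and> sets M = sets borel}"

definition borel_finite_measures :: "'a::topological_space measure set" where
  "borel_finite_measures = {M. finite_measure M \<and> sets M = sets borel}"


definition primal_feasible ::
  "nat \<Rightarrow> ('x::polish_space \<times> 'u::polish_space \<Rightarrow> 'x) \<Rightarrow> 'x measure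
    \<Rightarrow> (nat \<Rightarrow> 'x measure) \<Rightarrow> (nat \<Rightarrow> ('x \<times> 'u) measure) \<Rightarrow> bool" where
  "primal_feasible T f \<rho>0 \<rho> lam \<longleftrightarrow>
     \<rho> 0 = \<rho>0 \<and>
     (\<forall>t\<in>{1..T}. \<rho> t \<in> borel_prob_measures) \<and>
     (\<forall>t<T. lam t \<in> borel_prob_measures) \<and>
     (\<forall>t<T. distr (lam t) borel fst = \<rho> t) \<and>
     (\<forall>t<T. \<rho> (Suc t) = distr (lam t) borel f)"

definition primal_cost ::
  "nat \<Rightarrow> ('x \<times> 'u \<Rightarrow> real) \<Rightarrow> ('x \<Rightarrow> real)
    \<Rightarrow> (nat \<Rightarrow> 'x measure) \<Rightarrow> (nat \<Rightarrow> ('x \<times> 'u) measure) \<Rightarrow> real" where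
  "primal_cost T l \<phi> \<rho> lam = (\<Sum>t<T. \<integral>z. l z \<partial>lam t) + (\<integral>x. \<phi> x \<partial>\<rho> T)"

definition primal_value ::
  "nat \<Rightarrow> ('x::polish_space \<times> 'u::polish_space \<Rightarrow> 'x) \<Rightarrow> ('x \<times> 'u \<Rightarrow> real)
    \<Rightarrow> ('x \<Rightarrow> real) \<Rightarrow> 'x measure \<Rightarrow> ereal" where
  "primal_value T f l \<phi> \<rho>0 =
     (INF (\<rho>, lam) \<in> {(\<rho>, lam). primal_feasible T f \<rho>0 \<rho> lam}. ereal (primal_cost T l \<phi> \<rho> lam))"

definition primal_optimal ::
  "nat \<Rightarrow> ('x::polish_space \<times> 'u::polish_space \<Rightarrow> 'x) \<Rightarrow> ('x \<times> 'u \<Rightarrow> real)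
    \<Rightarrow> ('x \<Rightarrow> real) \<Rightarrow> 'x measure
    \<Rightarrow> (nat \<Rightarrow> 'x measure) \<Rightarrow> (nat \<Rightarrow> ('x \<times> 'u) measure) \<Rightarrow> bool" where
  "primal_optimal T f l \<phi> \<rho>0 \<rho> lam \<longleftrightarrow>
     primal_feasible T f \<rho>0 \<rho> lam \<and>
     ereal (primal_cost T l \<phi> \<rho> lam) = primal_value T f l \<phi> \<rho>0"


definition multipliers :: "nat \<Rightarrow> (nat \<Rightarrow> 'x::topological_space \<Rightarrow> real) set" where
  "multipliers T = {V. \<forall>t\<le>T. continuous_on UNIV (V t)}"

definition lagrangian ::
  "nat \<Rightarrow> ('x \<times> 'u \<Rightarrow> 'x) \<Rightarrow> ('x \<times> 'u \<Rightarrow> real) \<Rightarrow> ('x \<Rightarrow> real) \<Rightarrow> 'x measure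
    \<Rightarrow> (nat \<Rightarrow> ('x \<times> 'u) measure) \<Rightarrow> 'x measure \<Rightarrow> (nat \<Rightarrow> 'x \<Rightarrow> real) \<Rightarrow> real" where
  "lagrangian T f l \<phi> \<rho>0 lam \<rho>T V =
     (\<Sum>t<T. \<integral>z. l z + V (Suc t) (f z) - V t (fst z) \<partial>lam t)
     + (\<integral>x. \<phi> x - V T x \<partial>\<rho>T) + (\<integral>x. V 0 x \<partial>\<rho>0)"

definition dual_function ::
  "nat \<Rightarrow> ('x::polish_space \<times> 'u::polish_space \<Rightarrow> 'x) \<Rightarrow> ('x \<times> 'u \<Rightarrow> real)
    \<Rightarrow> ('x \<Rightarrow> real) \<Rightarrow> 'x measure \<Rightarrow> (nat \<Rightarrow> 'x \<Rightarrow> real) \<Rightarrow> ereal" where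
  "dual_function T f l \<phi> \<rho>0 V =
     (INF (lam, \<rho>T) \<in> {(lam, \<rho>T). (\<forall>t<T. lam t \<in> borel_finite_measures) \<and>
                                   \<rho>T \<in> borel_finite_measures}.
        ereal (lagrangian T f l \<phi> \<rho>0 lam \<rho>T V))"

definition lagrangian_dual_value ::
  "nat \<Rightarrow> ('x::polish_space \<times> 'u::polish_space \<Rightarrow> 'x) \<Rightarrow> ('x \<times> 'u \<Rightarrow> real)
    \<Rightarrow> ('x \<Rightarrow> real) \<Rightarrow> 'x measure \<Rightarrow> ereal" where
  "lagrangian_dual_value T f l \<phi> \<rho>0 = (SUP V \<in> multipliers T. dual_function T f l \<phi> \<rho>0 V)"


definition dual_feasible ::
  "nat \<Rightarrow> ('x::topological_space \<times> 'u \<Rightarrow> 'x) \<Rightarrow> ('x \<times> 'u \<Rightarrow> real) \<Rightarrow> ('x \<Rightarrow> real)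
    \<Rightarrow> (nat \<Rightarrow> 'x \<Rightarrow> real) \<Rightarrow> bool" where
  "dual_feasible T f l \<phi> V \<longleftrightarrow>
     V \<in> multipliers T \<and>
     (\<forall>x. V T x \<le> \<phi> x) \<and>
     (\<forall>t<T. \<forall>x u. V t x \<le> l (x, u) + V (Suc t) (f (x, u)))"

definition dual_value ::
  "nat \<Rightarrow> ('x::topological_space \<times> 'u \<Rightarrow> 'x) \<Rightarrow> ('x \<times> 'u \<Rightarrow> real) \<Rightarrow> ('x \<Rightarrow> real)
    \<Rightarrow> 'x measure \<Rightarrow> ereal" where
  "dual_value T f l \<phi> \<rho>0 = (SUP V \<in> {V. dual_feasible T f l \<phi> V}. ereal (\<integral>x. V 0 x \<partial>\<rho>0))"

definition dual_optimal ::
  "nat \<Rightarrow> ('x::topological_space \<times> 'u \<Rightarrow> 'x) \<Rightarrow> ('x \<times> 'u \<Rightarrow> real) \<Rightarrow> ('x \<Rightarrow> real)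
    \<Rightarrow> 'x measure \<Rightarrow> (nat \<Rightarrow> 'x \<Rightarrow> real) \<Rightarrow> bool" where
  "dual_optimal T f l \<phi> \<rho>0 V \<longleftrightarrow>
     dual_feasible T f l \<phi> V \<and> ereal (\<integral>x. V 0 x \<partial>\<rho>0) = dual_value T f l \<phi> \<rho>0"


text \<open>
  The backward recursion is indexed by the number of steps to go. The minimum over \<open>u\<close> is written
  as a real infimum, which is only meaningful if the range is bounded below; the theorem asserts
  separately that it is an attained minimum.
\<close>

primrec cost_to_go ::
  "('x \<times> 'u \<Rightarrow> 'x) \<Rightarrow> ('x \<times> 'u \<Rightarrow> real) \<Rightarrow> ('x \<Rightarrow> real) \<Rightarrow> nat \<Rightarrow> 'x \<Rightarrow> real" where
  "cost_to_go f l \<phi> 0 = \<phi>"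
| "cost_to_go f l \<phi> (Suc k) = (\<lambda>x. INF u. l (x, u) + cost_to_go f l \<phi> k (f (x, u)))"

definition bellman ::
  "nat \<Rightarrow> ('x \<times> 'u \<Rightarrow> 'x) \<Rightarrow> ('x \<times> 'u \<Rightarrow> real) \<Rightarrow> ('x \<Rightarrow> real) \<Rightarrow> nat \<Rightarrow> 'x \<Rightarrow> real" where
  "bellman T f l \<phi> t = cost_to_go f l \<phi> (T - t)"

end

theory Submission
  imports Defs
begin

text \<open>
  Everything rests on the reduced cost
  \<open>l (x, u) + V (t + 1) (f (x, u)) - V t x\<close> of a family of multipliers \<open>V\<close>, which is the integrand
  of the \<open>t\<close>-th term of the Lagrangian. Dual feasibility says exactly that all reduced costs and
  the terminal slack \<open>\<phi> - V T\<close> are nonnegative. The measures in the Lagrangian range over a cone,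
  so the infimum over them is reached at the zero measures when \<open>V\<close> is feasible, while otherwise a
  Dirac mass at a point of violation, scaled up, drives the Lagrangian to \<open>- \<infinity>\<close>
  (\<open>dual_function_eq\<close>). This identifies the Lagrangian dual.

  If the measures satisfy the flow equations, the terms containing \<open>V\<close> telescope and the Lagrangian
  equals the primal cost whatever \<open>V\<close> is (\<open>lagrangian_eq_primal_cost\<close>). Together with the
  nonnegativity of the reduced costs this is weak duality.

  The gap is closed by complementary slackness. By compactness the Bellman functions are continuous
  and their minima are attained, so they are dual feasible and for every state some control makes
  the reduced cost vanish (\<open>bellman_feasible_and_tight\<close>). Such controls can be chosen as a Borel
  function of the state (\<open>measurable_selection_zero_set\<close>). Propagating \<open>\<rho>0\<close> under the resulting
  feedback policy, with occupation measures carried by the graphs of the policy, gives a primal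
  feasible pair for which every reduced cost integrates to zero. Its cost is therefore the
  integral of the Bellman function at time zero (\<open>exists_primal_matching_bellman\<close>), and weak
  duality makes both sides optimal.
\<close>

section \<open>Integration of continuous functions on a compact space\<close>

lemma integrable_continuous_compact:
  fixes g :: "'a::topological_space \<Rightarrow> real"
  assumes comp: "compact (UNIV :: 'a set)"
    and g: "continuous_on UNIV g"
    and M: "finite_measure M" "sets M = sets borel"
  shows "integrable M g"
proof -
  interpret finite_measure M by (rule M)
  have "bounded (range g)"
    using compact_continuous_image[OF g comp] by (rule compact_imp_bounded)
  then obtain B where B: "\<And>x. norm (g x) \<le> B"
    by (auto simp: bounded_iff)
  have "g \<in> borel_measurable M"
    using borel_measurable_continuous_onI[OF g] M(2) measurable_cong_sets by blast
  then show ?thesis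
    using B by (intro integrable_const_bound[where B = B]) auto
qed

definition reduced_cost ::
  "('x \<times> 'u \<Rightarrow> 'x) \<Rightarrow> ('x \<times> 'u \<Rightarrow> real) \<Rightarrow> (nat \<Rightarrow> 'x \<Rightarrow> real) \<Rightarrow> nat \<Rightarrow> 'x \<times> 'u \<Rightarrow> real" where
  "reduced_cost f l V t z = l z + V (Suc t) (f z) - V t (fst z)"

lemma continuous_reduced_cost:
  assumes "continuous_on UNIV f" "continuous_on UNIV l" "V \<in> multipliers T" "t < T"
  shows "continuous_on UNIV (reduced_cost f l V t)"
proof -
  have V: "continuous_on UNIV (V t)" "continuous_on UNIV (V (Suc t))"
    using assms(3,4) by (auto simp: multipliers_def)
  have "continuous_on UNIV (\<lambda>z. V (Suc t) (f z))"
    by (rule continuous_on_compose2[OF V(2) assms(1)]) auto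
  moreover have "continuous_on UNIV (\<lambda>z. V t (fst z))"
    by (rule continuous_on_compose2[OF V(1)]) (auto intro: continuous_intros)
  ultimately show ?thesis
    unfolding reduced_cost_def [abs_def] using assms(2) by (intro continuous_intros)
qed

lemma lagrangian_reduced_cost:
  "lagrangian T f l \<phi> \<rho>0 lam \<rho>T V =
     (\<Sum>t<T. \<integral>z. reduced_cost f l V t z \<partial>lam t)
     + (\<integral>x. \<phi> x - V T x \<partial>\<rho>T) + (\<integral>x. V 0 x \<partial>\<rho>0)"
  by (simp add: lagrangian_def reduced_cost_def)

lemma dual_feasible_iff_reduced_cost:
  "dual_feasible T f l \<phi> V \<longleftrightarrow>
     V \<in> multipliers T \<and> (\<forall>x. 0 \<le> \<phi> x - V T x) \<and> (\<forall>t<T. \<forall>z. 0 \<le> reduced_cost f l V t z)"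
  by (auto simp: dual_feasible_def reduced_cost_def)

section \<open>The Lagrangian dual\<close>

text \<open>
  By the flow equations, integrating the reduced cost against \<open>lam t\<close> gives the running cost plus
  the increment from \<open>t\<close> to \<open>t + 1\<close> of the integral of \<open>V t\<close> against \<open>\<rho> t\<close>. Summed over time the
  increments telescope, and the two boundary terms cancel against those of the Lagrangian.
\<close>
lemma lagrangian_eq_primal_cost:
  fixes f :: "'x::polish_space \<times> 'u::polish_space \<Rightarrow> 'x"
  assumes compX: "compact (UNIV :: 'x set)" and compU: "compact (UNIV :: 'u set)"
    and f: "continuous_on UNIV f" and l: "continuous_on UNIV l" and \<phi>: "continuous_on UNIV \<phi>"
    and \<rho>0: "\<rho>0 \<in> borel_prob_measures"
    and V: "V \<in> multipliers T"
    and feas: "primal_feasible T f \<rho>0 \<rho> lam"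
  shows "lagrangian T f l \<phi> \<rho>0 lam (\<rho> T) V = primal_cost T l \<phi> \<rho> lam"
proof -
  have compXU: "compact (UNIV :: ('x \<times> 'u) set)"
    using compact_Times[OF compX compU] by simp
  have \<rho>: "finite_measure (\<rho> t)" "sets (\<rho> t) = sets borel" if "t \<le> T" for t
  proof -
    have "\<rho> t \<in> borel_prob_measures"
      using that feas \<rho>0 by (cases "t = 0") (simp_all add: primal_feasible_def)
    then show "finite_measure (\<rho> t)" "sets (\<rho> t) = sets borel"
      by (auto simp: borel_prob_measures_def prob_space.finite_measure)
  qed
  have lam: "finite_measure (lam t)" "sets (lam t) = sets borel" if "t < T" for t
    using that feas by (auto simp: primal_feasible_def borel_prob_measures_def prob_space.finite_measure)
  have Vc: "continuous_on UNIV (V t)" if "t \<le> T" for t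
    using V that by (auto simp: multipliers_def)
  have step: "(\<integral>z. reduced_cost f l V t z \<partial>lam t) =
      (\<integral>z. l z \<partial>lam t) + ((\<integral>x. V (Suc t) x \<partial>\<rho> (Suc t)) - (\<integral>x. V t x \<partial>\<rho> t))" if t: "t < T" for t
  proof -
    have Vf: "continuous_on UNIV (\<lambda>z. V (Suc t) (f z))"
      using t by (intro continuous_on_compose2[OF Vc f]) auto
    have Vfst: "continuous_on UNIV (\<lambda>z::'x \<times> 'u. V t (fst z))"
      using t by (intro continuous_on_compose2[OF Vc]) (auto intro: continuous_intros)
    note int = integrable_continuous_compact[OF compXU _ lam[OF t]]
    have meas: "g \<in> measurable (lam t) borel" if "continuous_on UNIV g"
      for g :: "'x \<times> 'u \<Rightarrow> 'x"
      using borel_measurable_continuous_onI[OF that] lam(2)[OF t] measurable_cong_sets by blast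
    have "(\<integral>x. V (Suc t) x \<partial>\<rho> (Suc t)) = (\<integral>x. V (Suc t) x \<partial>distr (lam t) borel f)"
      using feas t by (simp add: primal_feasible_def)
    also have "\<dots> = (\<integral>z. V (Suc t) (f z) \<partial>lam t)"
      using t by (intro integral_distr meas f borel_measurable_continuous_onI Vc) auto
    finally have next_state: "(\<integral>x. V (Suc t) x \<partial>\<rho> (Suc t)) = (\<integral>z. V (Suc t) (f z) \<partial>lam t)" .
    have "(\<integral>x. V t x \<partial>\<rho> t) = (\<integral>x. V t x \<partial>distr (lam t) borel fst)"
      using feas t by (simp add: primal_feasible_def)
    also have "\<dots> = (\<integral>z. V t (fst z) \<partial>lam t)"
      using t by (intro integral_distr meas borel_measurable_continuous_onI Vc)
        (auto intro: continuous_intros)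
    finally have state: "(\<integral>x. V t x \<partial>\<rho> t) = (\<integral>z. V t (fst z) \<partial>lam t)" .
    show ?thesis
      unfolding reduced_cost_def next_state state
      using int[OF l] int[OF Vf] int[OF Vfst] by simp
  qed
  have "(\<integral>x. \<phi> x - V T x \<partial>\<rho> T) = (\<integral>x. \<phi> x \<partial>\<rho> T) - (\<integral>x. V T x \<partial>\<rho> T)"
    using integrable_continuous_compact[OF compX _ \<rho>[OF order_refl]] \<phi> Vc[OF order_refl]
    by (intro Bochner_Integration.integral_diff) auto
  moreover have "(\<Sum>t<T. (\<integral>x. V (Suc t) x \<partial>\<rho> (Suc t)) - (\<integral>x. V t x \<partial>\<rho> t)) =
      (\<integral>x. V T x \<partial>\<rho> T) - (\<integral>x. V 0 x \<partial>\<rho>0)"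
    using sum_lessThan_telescope[of "\<lambda>t. \<integral>x. V t x \<partial>\<rho> t" T] feas
    by (simp add: primal_feasible_def)
  ultimately show ?thesis
    by (simp add: lagrangian_reduced_cost primal_cost_def step sum.distrib)
qed

text \<open>
  Combined with the previous lemma this is weak duality; on its own it bounds the dual function
  from below at feasible multipliers.
\<close>
lemma lagrangian_ge_if_dual_feasible:
  assumes "dual_feasible T f l \<phi> V"
  shows "(\<integral>x. V 0 x \<partial>\<rho>0) \<le> lagrangian T f l \<phi> \<rho>0 lam \<rho>T V"
  using assms
  by (auto simp: lagrangian_reduced_cost dual_feasible_iff_reduced_cost
      intro!: add_nonneg_nonneg sum_nonneg Bochner_Integration.integral_nonneg)

lemma null_measure_borel_finite [simp]: "null_measure borel \<in> borel_finite_measures"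
  by (auto simp: borel_finite_measures_def intro: finite_measureI)

lemma scaled_dirac_borel_finite:
  "density (return borel z) (\<lambda>_. ennreal c) \<in> borel_finite_measures"
  by (auto simp: borel_finite_measures_def emeasure_density intro!: finite_measureI)


lemma integral_scaled_dirac:
  fixes g :: "'a::topological_space \<Rightarrow> real"
  assumes "g \<in> borel_measurable borel" "0 \<le> c"
  shows "(\<integral>x. g x \<partial>density (return borel z) (\<lambda>_. ennreal c)) = c * g z"
  using assms by (simp add: integral_density integral_return)

text \<open>
  Unboundedness along a ray: \<open>c\<close> plays the role of the mass placed on a violated constraint and
  \<open>b\<close> that of the amount of the violation.
\<close>
lemma ereal_INF_eq_minfty:
  fixes a b :: real
  assumes "b < 0" "\<And>c. 0 \<le> c \<Longrightarrow> \<exists>i\<in>I. F i = ereal (a + c * b)"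
  shows "(INF i\<in>I. F i) = - \<infinity>"
proof (rule ereal_bot)
  fix B :: real
  \<comment> \<open>the mass at which the ray reaches the level \<open>B\<close>, truncated to stay in the cone\<close>
  define c where "c = max 0 ((B - a) / b)"
  have "c * b \<le> B - a"
  proof -
    have "(B - a) / b \<le> c" by (simp add: c_def)
    then show ?thesis using assms(1) by (simp add: neg_divide_le_eq)
  qed
  moreover obtain i where "i \<in> I" "F i = ereal (a + c * b)"
    using assms(2)[of c] by (auto simp: c_def)
  ultimately show "(INF i\<in>I. F i) \<le> ereal B"
    by (intro INF_lower2[of i]) auto
qed

lemma dual_function_eq:
  fixes f :: "'x::polish_space \<times> 'u::polish_space \<Rightarrow> 'x"
  assumes f: "continuous_on UNIV f" and l: "continuous_on UNIV l" and \<phi>: "continuous_on UNIV \<phi>"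
    and V: "V \<in> multipliers T"
  shows "dual_function T f l \<phi> \<rho>0 V =
    (if dual_feasible T f l \<phi> V then ereal (\<integral>x. V 0 x \<partial>\<rho>0) else - \<infinity>)"
proof (cases "dual_feasible T f l \<phi> V")
  case True
  have "dual_function T f l \<phi> \<rho>0 V = ereal (\<integral>x. V 0 x \<partial>\<rho>0)"
  proof (rule antisym)
    show "dual_function T f l \<phi> \<rho>0 V \<le> ereal (\<integral>x. V 0 x \<partial>\<rho>0)"
      unfolding dual_function_def
      by (rule INF_lower2[of "(\<lambda>_. null_measure borel, null_measure borel)"])
        (auto simp: lagrangian_def)
    show "ereal (\<integral>x. V 0 x \<partial>\<rho>0) \<le> dual_function T f l \<phi> \<rho>0 V"
      unfolding dual_function_def
      by (rule INF_greatest) (auto intro: lagrangian_ge_if_dual_feasible[OF True])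
  qed
  with True show ?thesis by simp
next
  case False
  let ?I = "{(lam, \<rho>T). (\<forall>t<T. lam t \<in> borel_finite_measures) \<and> \<rho>T \<in> borel_finite_measures}"
  let ?L = "\<lambda>(lam, \<rho>T). ereal (lagrangian T f l \<phi> \<rho>0 lam \<rho>T V)"
  let ?N = "\<lambda>_::nat. null_measure borel :: ('x \<times> 'u) measure"
  from False V consider (terminal) x where "\<phi> x - V T x < 0"
    | (running) t z where "t < T" "reduced_cost f l V t z < 0"
    by (auto simp: dual_feasible_iff_reduced_cost not_le)
  then have "(INF p\<in>?I. ?L p) = - \<infinity>"
  proof cases
    case terminal
    show ?thesis
    proof (rule ereal_INF_eq_minfty[OF terminal, where a = "\<integral>x. V 0 x \<partial>\<rho>0"])
      fix c :: real assume c: "0 \<le> c"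
      let ?\<mu> = "density (return borel x) (\<lambda>_. ennreal c)"
      have "(\<lambda>x. \<phi> x - V T x) \<in> borel_measurable borel"
        using \<phi> V by (intro borel_measurable_continuous_onI continuous_intros)
          (auto simp: multipliers_def)
      then have "?L (?N, ?\<mu>) = ereal ((\<integral>x. V 0 x \<partial>\<rho>0) + c * (\<phi> x - V T x))"
        using integral_scaled_dirac[OF _ c] by (simp add: lagrangian_def)
      moreover have "(?N, ?\<mu>) \<in> ?I"
        by (simp add: scaled_dirac_borel_finite)
      ultimately show "\<exists>p\<in>?I. ?L p = ereal ((\<integral>x. V 0 x \<partial>\<rho>0) + c * (\<phi> x - V T x))"
        by blast
    qed
  next
    case running
    show ?thesis
    proof (rule ereal_INF_eq_minfty[OF running(2), where a = "\<integral>x. V 0 x \<partial>\<rho>0"])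
      fix c :: real assume c: "0 \<le> c"
      let ?lam = "?N(t := density (return borel z) (\<lambda>_. ennreal c))"
      have "reduced_cost f l V t \<in> borel_measurable borel"
        using continuous_reduced_cost[OF f l V running(1)] by (rule borel_measurable_continuous_onI)
      then have "(\<integral>z. reduced_cost f l V s z \<partial>?lam s) =
          (if s = t then c * reduced_cost f l V t z else 0)" for s
        using integral_scaled_dirac[OF _ c] by auto
      then have "?L (?lam, null_measure borel) =
          ereal ((\<integral>x. V 0 x \<partial>\<rho>0) + c * reduced_cost f l V t z)"
        using running(1) by (simp add: lagrangian_reduced_cost)
      moreover have "(?lam, null_measure borel) \<in> ?I"
        by (simp add: scaled_dirac_borel_finite)
      ultimately show "\<exists>p\<in>?I. ?L p = ereal ((\<integral>x. V 0 x \<partial>\<rho>0) + c * reduced_cost f l V t z)"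
        by blast
    qed
  qed
  with False show ?thesis by (simp add: dual_function_def)
qed

section \<open>Continuity and attainment in the Bellman recursion\<close>

lemma compact_INF_attained:
  fixes h :: "'u::topological_space \<Rightarrow> real"
  assumes "compact (UNIV :: 'u set)" "continuous_on UNIV h"
  shows "\<exists>u. (INF v. h v) = h u" and "(INF v. h v) \<le> h u"
proof -
  obtain w where w: "\<And>v. h w \<le> h v"
    using continuous_attains_inf[OF assms(1) _ assms(2)] by auto
  then have "(INF v. h v) = h w"
    by (intro cInf_eq_minimum) auto
  with w show "\<exists>u. (INF v. h v) = h u" "(INF v. h v) \<le> h u" by auto
qed

text \<open>
  On a compact product \<open>q\<close> is uniformly continuous, so for nearby \<open>x\<close> and \<open>x'\<close> a minimizer for \<open>x\<close>
  is almost a minimizer for \<open>x'\<close>. Compactness of the control space makes this estimate uniform in \<open>u\<close>.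
\<close>
lemma continuous_on_INF_compact:
  fixes q :: "'x::metric_space \<times> 'u::metric_space \<Rightarrow> real"
  assumes compX: "compact (UNIV :: 'x set)" and compU: "compact (UNIV :: 'u set)"
    and q: "continuous_on UNIV q"
  shows "continuous_on UNIV (\<lambda>x. INF u. q (x, u))"
proof -
  have sec: "continuous_on UNIV (\<lambda>u. q (x, u))" for x
    by (rule continuous_on_compose2[OF q]) (auto intro: continuous_intros)
  note att = compact_INF_attained[OF compU sec]
  have "uniformly_continuous_on UNIV q"
    using compact_uniformly_continuous[OF q] compact_Times[OF compX compU] by simp
  note uc = this[unfolded uniformly_continuous_on_def, rule_format]
  have "uniformly_continuous_on UNIV (\<lambda>x. INF u. q (x, u))"
    unfolding uniformly_continuous_on_def
  proof (intro allI impI)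
    fix e :: real assume "0 < e"
    from uc[OF this] obtain d where d: "0 < d"
      and close: "\<And>z z'. dist z' z < d \<Longrightarrow> dist (q z') (q z) < e" by auto
    have le: "(INF u. q (x', u)) < (INF u. q (x, u)) + e" if "dist x' x < d" for x x'
    proof -
      obtain u where u: "(INF u. q (x, u)) = q (x, u)" using att(1) by blast
      have "dist (q (x', u)) (q (x, u)) < e"
        using that by (intro close) (simp add: dist_Pair_Pair)
      then show ?thesis
        using att(2)[of x' u] u by (auto simp: dist_real_def)
    qed
    show "\<exists>d>0. \<forall>x\<in>UNIV. \<forall>x'\<in>UNIV. dist x' x < d \<longrightarrow>
        dist (INF u. q (x', u)) (INF u. q (x, u)) < e"
    proof (intro exI[of _ d] conjI ballI impI d)
      fix x x' :: 'x assume "dist x' x < d"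
      then show "dist (INF u. q (x', u)) (INF u. q (x, u)) < e"
        using le[of x' x] le[of x x'] by (simp add: dist_commute dist_real_def abs_less_iff)
    qed
  qed
  then show ?thesis by (rule uniformly_continuous_imp_continuous)
qed

lemma continuous_on_cost_to_go:
  fixes f :: "'x::metric_space \<times> 'u::metric_space \<Rightarrow> 'x"
  assumes "compact (UNIV :: 'x set)" "compact (UNIV :: 'u set)"
    and "continuous_on UNIV f" "continuous_on UNIV l" "continuous_on UNIV \<phi>"
  shows "continuous_on UNIV (cost_to_go f l \<phi> k)"
proof (induction k)
  case 0
  then show ?case using assms(5) by simp
next
  case (Suc k)
  have "continuous_on UNIV (\<lambda>z. l z + cost_to_go f l \<phi> k (f z))"
    by (intro continuous_on_add assms(4) continuous_on_compose2[OF Suc assms(3)]) auto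
  from continuous_on_INF_compact[OF assms(1,2) this] show ?case by simp
qed

lemma bellman_step:
  assumes "t < T"
  shows "bellman T f l \<phi> t x = (INF u. l (x, u) + bellman T f l \<phi> (Suc t) (f (x, u)))"
proof -
  have "T - t = Suc (T - Suc t)" using assms by simp
  then show ?thesis by (simp add: bellman_def)
qed

section \<open>Measurable selection of minimizing controls\<close>

lemma Cauchy_if_dist_le_geometric:
  fixes a :: "nat \<Rightarrow> 'a::metric_space"
  assumes step: "\<And>k. dist (a (Suc k)) (a k) \<le> c * (1/2)^k" and "0 < c"
  shows "Cauchy a"
proof -
  have tail: "dist (a (k + j)) (a k) \<le> 2 * c * ((1/2)^k - (1/2)^(k + j))" for j k
  proof (induction j)
    case (Suc j)
    have "dist (a (k + Suc j)) (a k) \<le> c * (1/2)^(k + j) + 2 * c * ((1/2)^k - (1/2)^(k + j))"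
      using dist_triangle[of "a (Suc (k + j))" "a k" "a (k + j)"] step[of "k + j"] Suc by simp
    then show ?case by (simp add: algebra_simps)
  qed simp
  show ?thesis
    unfolding Cauchy_altdef2
  proof (intro allI impI)
    fix e :: real assume "0 < e"
    with \<open>0 < c\<close> obtain k where k: "(1/2)^k < e / (2 * c)"
      using real_arch_pow_inv[of "e / (2 * c)" "1/2"] by auto
    have "dist (a n) (a k) < e" if "k \<le> n" for n
    proof -
      have "dist (a n) (a k) \<le> 2 * c * ((1/2)^k - (1/2)^n)"
        using tail[of k "n - k"] that by simp
      also have "\<dots> \<le> 2 * c * (1/2)^k" using \<open>0 < c\<close> by simp
      also have "\<dots> < e" using k \<open>0 < c\<close> by (simp add: field_simps)
      finally show ?thesis .
    qed
    then show "\<exists>N. \<forall>n\<ge>N. dist (a n) (a N) < e" by blast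
  qed
qed

text \<open>
  This is the Kuratowski--Ryll-Nardzewski construction. The selector is the limit of functions
  \<open>a k\<close> with values in a countable dense set that stay within \<open>(1/2) ^ k\<close> of the zero set of the
  section of \<open>g\<close> at \<open>x\<close>. Each refinement takes the first dense point that meets the next tolerance
  and moves by at most \<open>2 * (1/2) ^ k\<close>. Choosing the first such point keeps \<open>a k\<close> measurable, because
  the set of states at which a given point meets a given tolerance is the projection of a
  compact set, hence closed.
\<close>
lemma measurable_selection_zero_set:
  fixes g :: "'x::metric_space \<times> 'u::polish_space \<Rightarrow> real"
  assumes compX: "compact (UNIV :: 'x set)" and compU: "compact (UNIV :: 'u set)"
    and g: "continuous_on UNIV g"
    and zero: "\<And>x. \<exists>u. g (x, u) = 0"
  obtains s where "s \<in> borel_measurable borel" "\<And>x. g (x, s x) = 0"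
proof -
  define near where "near k v x \<longleftrightarrow> (\<exists>u. g (x, u) = 0 \<and> dist v u \<le> (1/2)^k)" for k :: nat and v x
  have [measurable]: "Measurable.pred borel (near k v)" for k v
  proof -
    let ?K = "{z. g z = 0} \<inter> {z. dist v (snd z) \<le> (1/2)^k}"
    have "closed ?K"
      by (intro closed_Int closed_Collect_eq closed_Collect_le g continuous_intros)
    then have "compact ?K"
      using compact_Int_closed[OF compact_Times[OF compX compU]] by simp
    then have "compact (fst ` ?K)"
      by (intro compact_continuous_image continuous_intros)
    moreover have "{x \<in> space borel. near k v x} = fst ` ?K"
      by (force simp: near_def)
    ultimately show ?thesis
      unfolding pred_def by (simp add: compact_imp_closed)
  qed
  obtain D :: "'u set" where D: "countable D" "\<And>S. open S \<Longrightarrow> S \<noteq> {} \<Longrightarrow> \<exists>d\<in>D. d \<in> S"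
    by (rule countable_dense_setE) blast
  define d where "d = from_nat_into D"
  have dense: "\<exists>n. dist (d n) u \<le> e" if "0 < e" for u and e :: real
  proof -
    obtain v where v: "v \<in> D" "v \<in> ball u e" using D(2)[of "ball u e"] \<open>0 < e\<close> by auto
    then obtain n where "d n = v" using from_nat_into_surj[OF D(1)] by (auto simp: d_def)
    with v show ?thesis by (intro exI[of _ n]) (auto simp: dist_commute)
  qed
  define a where "a = rec_nat (\<lambda>x. d (LEAST n. near 0 (d n) x))
      (\<lambda>k b x. d (LEAST n. near (Suc k) (d n) x \<and> dist (d n) (b x) \<le> 2 * (1/2)^k))"
  have a0: "a 0 = (\<lambda>x. d (LEAST n. near 0 (d n) x))"
    and aS: "a (Suc k) =
      (\<lambda>x. d (LEAST n. near (Suc k) (d n) x \<and> dist (d n) (a k x) \<le> 2 * (1/2)^k))" for k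
    by (simp_all add: a_def)
  have a_meas [measurable]: "a k \<in> borel_measurable borel" for k
  proof (induction k)
    case 0
    show ?case unfolding a0 by measurable
  next
    case (Suc k)
    note [measurable] = Suc
    show ?case unfolding aS by measurable
  qed
  \<comment> \<open>approximate a zero close to \<open>v\<close>: the two tolerances add up to \<open>3/2 * (1/2) ^ k\<close>\<close>
  have refine: "\<exists>n. near (Suc k) (d n) x \<and> dist (d n) v \<le> 2 * (1/2)^k" if "near k v x" for k v x
  proof -
    obtain u where u: "g (x, u) = 0" "dist v u \<le> (1/2)^k"
      using \<open>near k v x\<close> by (auto simp: near_def)
    obtain n where n: "dist (d n) u \<le> (1/2)^Suc k" using dense[of "(1/2)^Suc k" u] by auto
    have "dist (d n) v \<le> (1/2)^Suc k + (1/2)^k"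
      using dist_triangle2[of "d n" v u] u(2) n by linarith
    also have "\<dots> \<le> 2 * (1/2)^k" by simp
    finally have "dist (d n) v \<le> 2 * (1/2)^k" .
    then show ?thesis using u(1) n by (auto simp: near_def)
  qed
  have near_a: "near k (a k x) x" for k x
  proof (induction k)
    case 0
    obtain u where "g (x, u) = 0" using zero by blast
    moreover obtain n where "dist (d n) u \<le> 1" using dense[of 1 u] by auto
    ultimately have "near 0 (d n) x" by (auto simp: near_def)
    then show ?case unfolding a0 by (rule LeastI)
  next
    case (Suc k)
    from LeastI_ex[OF refine[OF Suc]] show ?case unfolding aS by blast
  qed
  have "dist (a (Suc k) x) (a k x) \<le> 2 * (1/2)^k" for k x
    using LeastI_ex[OF refine[OF near_a[of k x]]] unfolding aS by blast
  then have "Cauchy (\<lambda>k. a k x)" for x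
    by (rule Cauchy_if_dist_le_geometric) simp
  then have lim: "(\<lambda>k. a k x) \<longlonglongrightarrow> lim (\<lambda>k. a k x)" for x
    by (simp add: Cauchy_convergent_iff convergent_LIMSEQ_iff)
  define s where "s x = lim (\<lambda>k. a k x)" for x
  have "s \<in> borel_measurable borel"
    unfolding s_def [abs_def] using a_meas lim by (rule borel_measurable_LIMSEQ_metric)
  moreover have "g (x, s x) = 0" for x
  proof -
    obtain u where u: "\<And>k. g (x, u k) = 0" "\<And>k. dist (a k x) (u k) \<le> (1/2)^k"
      using near_a[of _ x] unfolding near_def by metis
    have bound: "dist (u k) (s x) \<le> (1/2)^k + dist (a k x) (s x)" for k
      using dist_triangle3[of "u k" "s x" "a k x"] u(2)[of k] by linarith
    have "(\<lambda>k. (1/2)^k + dist (a k x) (s x)) \<longlonglongrightarrow> 0 + 0"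
      using lim[of x, folded s_def, THEN tendsto_dist_iff[THEN iffD1]]
      by (intro tendsto_add LIMSEQ_realpow_zero) simp_all
    then have "(\<lambda>k. (1/2)^k + dist (a k x) (s x)) \<longlonglongrightarrow> 0" by simp
    then have "(\<lambda>k. dist (u k) (s x)) \<longlonglongrightarrow> 0"
      by (rule Lim_null_comparison[rotated]) (simp add: bound)
    then have "u \<longlonglongrightarrow> s x" by (rule tendsto_dist_iff[THEN iffD2])
    then have "(\<lambda>k. g (x, u k)) \<longlonglongrightarrow> g (x, s x)"
      by (intro continuous_on_tendsto_compose[OF g] tendsto_intros) auto
    then show ?thesis using u(1) by (simp add: LIMSEQ_const_iff)
  qed
  ultimately show ?thesis by (rule that)
qed

section \<open>An optimal pair without duality gap\<close>

text \<open>
  The law at time \<open>t\<close> of the state that starts from \<open>\<rho>0\<close> and is driven by the feedback policy \<open>s\<close>,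
  and the joint law of state and control at that time.
\<close>
primrec policy_marginal ::
  "('x \<times> 'u \<Rightarrow> 'x) \<Rightarrow> (nat \<Rightarrow> 'x \<Rightarrow> 'u) \<Rightarrow> 'x::topological_space measure \<Rightarrow> nat \<Rightarrow> 'x measure" where
  "policy_marginal f s \<rho>0 0 = \<rho>0"
| "policy_marginal f s \<rho>0 (Suc t) = distr (policy_marginal f s \<rho>0 t) borel (\<lambda>x. f (x, s t x))"

definition policy_occupation ::
  "('x \<times> 'u \<Rightarrow> 'x) \<Rightarrow> (nat \<Rightarrow> 'x \<Rightarrow> 'u) \<Rightarrow> 'x::topological_space measure \<Rightarrow> nat
    \<Rightarrow> ('x \<times> 'u::topological_space) measure" where
  "policy_occupation f s \<rho>0 t = distr (policy_marginal f s \<rho>0 t) borel (\<lambda>x. (x, s t x))"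

lemma policy_feasible:
  fixes f :: "'x::polish_space \<times> 'u::polish_space \<Rightarrow> 'x"
  assumes f: "f \<in> borel_measurable borel" and s: "\<And>t. s t \<in> borel_measurable borel"
    and \<rho>0: "\<rho>0 \<in> borel_prob_measures"
  shows "primal_feasible T f \<rho>0 (policy_marginal f s \<rho>0) (policy_occupation f s \<rho>0)"
proof -
  note [measurable] = f s
  have [measurable]: "(fst :: 'x \<times> 'u \<Rightarrow> 'x) \<in> borel_measurable borel"
    by (intro borel_measurable_continuous_onI continuous_intros)
  let ?\<rho> = "policy_marginal f s \<rho>0"
  have graph [measurable]: "(\<lambda>x. (x, s t x)) \<in> borel_measurable borel" for t
    by measurable
  have prob: "prob_space (?\<rho> t) \<and> sets (?\<rho> t) = sets borel" for t
  proof (induction t)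
    case 0
    then show ?case using \<rho>0 by (simp add: borel_prob_measures_def)
  next
    case (Suc t)
    then have [measurable_cong]: "sets (?\<rho> t) = sets borel" by simp
    show ?case using Suc by (auto intro!: prob_space.prob_space_distr)
  qed
  then have [measurable_cong]: "sets (?\<rho> t) = sets borel" for t by simp
  have "prob_space (policy_occupation f s \<rho>0 t)" for t
    unfolding policy_occupation_def using prob by (intro prob_space.prob_space_distr) auto
  moreover have "distr (policy_occupation f s \<rho>0 t) borel fst = ?\<rho> t" for t
  proof -
    have "distr (policy_occupation f s \<rho>0 t) borel fst = distr (?\<rho> t) borel (\<lambda>x. x)"
      unfolding policy_occupation_def
      by (subst distr_distr) (auto simp: comp_def)
    then show ?thesis using prob by (simp add: distr_id2)
  qed
  moreover have "?\<rho> (Suc t) = distr (policy_occupation f s \<rho>0 t) borel f" for t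
    unfolding policy_occupation_def
    by (subst distr_distr) (auto simp: comp_def)
  ultimately show ?thesis
    using prob by (simp add: primal_feasible_def borel_prob_measures_def policy_occupation_def)
qed

text \<open>
  The Bellman recursion is the requirement that each feasibility constraint for time \<open>t\<close> be tight
  for at least one control; a control that makes it tight is a minimizer.
\<close>
lemma bellman_feasible_and_tight:
  fixes f :: "'x::metric_space \<times> 'u::metric_space \<Rightarrow> 'x"
  assumes compX: "compact (UNIV :: 'x set)" and compU: "compact (UNIV :: 'u set)"
    and f: "continuous_on UNIV f" and l: "continuous_on UNIV l" and \<phi>: "continuous_on UNIV \<phi>"
  shows "dual_feasible T f l \<phi> (bellman T f l \<phi>)"
    and "t < T \<Longrightarrow> \<exists>u. reduced_cost f l (bellman T f l \<phi>) t (x, u) = 0"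
proof -
  let ?B = "bellman T f l \<phi>"
  have B: "continuous_on UNIV (?B t)" for t
    unfolding bellman_def by (rule continuous_on_cost_to_go[OF assms])
  have "continuous_on UNIV (\<lambda>u. l (x, u) + ?B (Suc t) (f (x, u)))" for t x
    by (intro continuous_on_add continuous_on_compose2[OF l] continuous_on_compose2[OF B]
        continuous_on_compose2[OF f] continuous_intros) auto
  note att = compact_INF_attained[OF compU this]
  show "\<exists>u. reduced_cost f l ?B t (x, u) = 0" if "t < T"
    using att(1)[of x t] bellman_step[OF that, of f l \<phi> x] by (auto simp: reduced_cost_def)
  show "dual_feasible T f l \<phi> ?B"
    using B att(2) by (simp add: dual_feasible_def multipliers_def bellman_step)
      (simp add: bellman_def)
qed

text \<open>
  Complementary slackness: the occupation measures sit on the graph of a minimizing policy, where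
  the reduced costs of the Bellman functions vanish, and the terminal slack is identically zero.
  Hence in the Lagrangian only the integral against \<open>\<rho>0\<close> survives.
\<close>
lemma exists_primal_matching_bellman:
  fixes f :: "'x::polish_space \<times> 'u::polish_space \<Rightarrow> 'x"
  assumes compX: "compact (UNIV :: 'x set)" and compU: "compact (UNIV :: 'u set)"
    and f: "continuous_on UNIV f" and l: "continuous_on UNIV l" and \<phi>: "continuous_on UNIV \<phi>"
    and \<rho>0: "\<rho>0 \<in> borel_prob_measures"
  obtains \<rho> lam where "primal_feasible T f \<rho>0 \<rho> lam"
    and "primal_cost T l \<phi> \<rho> lam = (\<integral>x. bellman T f l \<phi> 0 x \<partial>\<rho>0)"
proof -
  let ?B = "bellman T f l \<phi>"
  note feas = bellman_feasible_and_tight[OF compX compU f l \<phi>]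
  then have mult: "?B \<in> multipliers T" by (simp add: dual_feasible_def)
  have "\<exists>s. s \<in> borel_measurable borel \<and> (t < T \<longrightarrow> (\<forall>x. reduced_cost f l ?B t (x, s x) = 0))" for t
  proof (cases "t < T")
    case True
    show ?thesis
      using measurable_selection_zero_set[OF compX compU
          continuous_reduced_cost[OF f l mult True] feas(2)[OF True]] by metis
  next
    case False
    \<comment> \<open>beyond the horizon any measurable control will do\<close>
    then show ?thesis by (intro exI[of _ "\<lambda>_. undefined"]) simp
  qed
  then obtain s where s: "\<And>t. s t \<in> borel_measurable borel"
    and opt: "\<And>t x. t < T \<Longrightarrow> reduced_cost f l ?B t (x, s t x) = 0"
    by metis
  let ?\<rho> = "policy_marginal f s \<rho>0" and ?lam = "policy_occupation f s \<rho>0"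
  have primal: "primal_feasible T f \<rho>0 ?\<rho> ?lam"
    using borel_measurable_continuous_onI[OF f] s \<rho>0 by (rule policy_feasible)
  have "(\<integral>z. reduced_cost f l ?B t z \<partial>?lam t) = 0" if t: "t < T" for t
  proof -
    have [measurable]: "reduced_cost f l ?B t \<in> borel_measurable borel"
      using continuous_reduced_cost[OF f l mult t] by (rule borel_measurable_continuous_onI)
    note [measurable] = s
    have [measurable_cong]: "sets (?\<rho> t) = sets borel"
      using \<rho>0 by (cases t) (simp_all add: borel_prob_measures_def)
    show ?thesis
      unfolding policy_occupation_def
      using opt[OF t] by (subst integral_distr) auto
  qed
  moreover have "?B T = \<phi>" by (simp add: bellman_def)
  ultimately have "lagrangian T f l \<phi> \<rho>0 ?lam (?\<rho> T) ?B = (\<integral>x. ?B 0 x \<partial>\<rho>0)"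
    by (simp add: lagrangian_reduced_cost)
  then show ?thesis
    using that[OF primal] lagrangian_eq_primal_cost[OF compX compU f l \<phi> \<rho>0 mult primal] by simp
qed

theorem theorem3p2:
  fixes T :: nat
    and f :: "'x::polish_space \<times> 'u::polish_space \<Rightarrow> 'x"
    and l :: "'x \<times> 'u \<Rightarrow> real"
    and \<phi> :: "'x \<Rightarrow> real"
    and \<rho>0 :: "'x measure"
  assumes "compact (UNIV :: 'x set)" and "compact (UNIV :: 'u set)"
    and "continuous_on UNIV f" and "continuous_on UNIV l" and "continuous_on UNIV \<phi>"
    and "\<rho>0 \<in> borel_prob_measures"
  shows "(\<forall>V \<in> multipliers T. dual_function T f l \<phi> \<rho>0 V =
             (if dual_feasible T f l \<phi> V then ereal (\<integral>x. V 0 x \<partial>\<rho>0) else - \<infinity>))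
       \<and> lagrangian_dual_value T f l \<phi> \<rho>0 = dual_value T f l \<phi> \<rho>0
       \<and> primal_value T f l \<phi> \<rho>0 = dual_value T f l \<phi> \<rho>0
       \<and> bellman T f l \<phi> T = \<phi>
       \<and> (\<forall>t<T. \<forall>x.
             (\<exists>u. bellman T f l \<phi> t x = l (x, u) + bellman T f l \<phi> (Suc t) (f (x, u))) \<and>
             (\<forall>u. bellman T f l \<phi> t x \<le> l (x, u) + bellman T f l \<phi> (Suc t) (f (x, u))))
       \<and> dual_optimal T f l \<phi> \<rho>0 (bellman T f l \<phi>)
       \<and> (\<exists>\<rho> lam. primal_optimal T f l \<phi> \<rho>0 \<rho> lam)"
proof -
  let ?B = "bellman T f l \<phi>" and ?v = "\<integral>x. bellman T f l \<phi> 0 x \<partial>\<rho>0"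
  note feas = bellman_feasible_and_tight[OF assms(1-5)]
  have dual_fun: "dual_function T f l \<phi> \<rho>0 V =
      (if dual_feasible T f l \<phi> V then ereal (\<integral>x. V 0 x \<partial>\<rho>0) else - \<infinity>)"
    if "V \<in> multipliers T" for V
    using assms(3-5) that by (rule dual_function_eq)
  have weak: "(\<integral>x. V 0 x \<partial>\<rho>0) \<le> primal_cost T l \<phi> \<rho> lam"
    if V: "dual_feasible T f l \<phi> V" and p: "primal_feasible T f \<rho>0 \<rho> lam" for V \<rho> lam
    using lagrangian_ge_if_dual_feasible[OF V] lagrangian_eq_primal_cost[OF assms _ p] V
    by (metis dual_feasible_def)
  obtain \<rho> lam where p: "primal_feasible T f \<rho>0 \<rho> lam" and cost: "primal_cost T l \<phi> \<rho> lam = ?v"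
    using exists_primal_matching_bellman[OF assms] .
  have primal_value: "primal_value T f l \<phi> \<rho>0 = ereal ?v"
    unfolding primal_value_def
  proof (rule antisym)
    show "(INF (\<rho>, lam)\<in>{(\<rho>, lam). primal_feasible T f \<rho>0 \<rho> lam}.
        ereal (primal_cost T l \<phi> \<rho> lam)) \<le> ereal ?v"
      using p cost by (intro INF_lower2[of "(\<rho>, lam)"]) auto
    show "ereal ?v \<le> (INF (\<rho>, lam)\<in>{(\<rho>, lam). primal_feasible T f \<rho>0 \<rho> lam}.
        ereal (primal_cost T l \<phi> \<rho> lam))"
      using weak[OF feas(1)] by (intro INF_greatest) auto
  qed
  have dual_value: "dual_value T f l \<phi> \<rho>0 = ereal ?v"
    unfolding dual_value_def
  proof (rule antisym)
    show "(SUP V\<in>{V. dual_feasible T f l \<phi> V}. ereal (\<integral>x. V 0 x \<partial>\<rho>0)) \<le> ereal ?v"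
      using weak[OF _ p] cost by (intro SUP_least) auto
    show "ereal ?v \<le> (SUP V\<in>{V. dual_feasible T f l \<phi> V}. ereal (\<integral>x. V 0 x \<partial>\<rho>0))"
      using feas(1) by (intro SUP_upper2[of ?B]) auto
  qed
  have "lagrangian_dual_value T f l \<phi> \<rho>0 = dual_value T f l \<phi> \<rho>0"
    unfolding lagrangian_dual_value_def dual_value_def
  proof (rule antisym)
    show "(SUP V\<in>multipliers T. dual_function T f l \<phi> \<rho>0 V) \<le>
        (SUP V\<in>{V. dual_feasible T f l \<phi> V}. ereal (\<integral>x. V 0 x \<partial>\<rho>0))"
      by (intro SUP_least) (auto simp: dual_fun intro: SUP_upper)
    show "(SUP V\<in>{V. dual_feasible T f l \<phi> V}. ereal (\<integral>x. V 0 x \<partial>\<rho>0)) \<le>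
        (SUP V\<in>multipliers T. dual_function T f l \<phi> \<rho>0 V)"
    proof (intro SUP_least)
      fix V assume "V \<in> {V. dual_feasible T f l \<phi> V}"
      then show "ereal (\<integral>x. V 0 x \<partial>\<rho>0) \<le> (SUP V\<in>multipliers T. dual_function T f l \<phi> \<rho>0 V)"
        by (intro SUP_upper2[of V]) (auto simp: dual_fun dual_feasible_def)
    qed
  qed
  moreover have "?B T = \<phi>" by (simp add: bellman_def)
  moreover have "\<forall>t<T. \<forall>x. (\<exists>u. ?B t x = l (x, u) + ?B (Suc t) (f (x, u))) \<and>
      (\<forall>u. ?B t x \<le> l (x, u) + ?B (Suc t) (f (x, u)))"
  proof (intro allI impI conjI)
    fix t x u assume t: "t < T"
    show "\<exists>u. ?B t x = l (x, u) + ?B (Suc t) (f (x, u))"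
      using feas(2)[OF t, of x] by (simp add: reduced_cost_def) metis
    show "?B t x \<le> l (x, u) + ?B (Suc t) (f (x, u))"
      using feas(1) t by (simp add: dual_feasible_def)
  qed
  moreover have "dual_optimal T f l \<phi> \<rho>0 ?B"
    using feas(1) dual_value by (simp add: dual_optimal_def)
  moreover have "primal_optimal T f l \<phi> \<rho>0 \<rho> lam"
    using p cost primal_value by (simp add: primal_optimal_def)
  ultimately show ?thesis
    using dual_fun primal_value dual_value by metis
qed

end
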